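(* Right reductions are terminating on connected diagrams: there is no infinite sequence $D_0\to_R D_1\to_R D_2\to_R\cdots$ of right exchanges starting from a valid connected diagram $D_0$.
   Context: A diagram is a tuple $D=(S,N,H,I,O)$ with $S,N\in\mathbb N$ and $H,I,O:\{0,\dots,N-1\}\to\mathbb N$; $\Delta(n)=O(n)-I(n)$, $W(0)=S$, $W(n+1)=W(n)+\Delta(n)$; $D$ is valid if $W(n)\ge H(n)+I(n)$ for all $n<N$. Geometrically, the vertex at height $n$ (heights numbered top to bottom) has as inputs the wires $H(n),\dots,H(n)+I(n)-1$ among the $W(n)$ wires crossing level $n$ (numbered left to right) and as outputs the wires $H(n),\dots,H(n)+O(n)-1$ of level $n+1$; wire $k<H(n)$ of level $n$ continues as wire $k$ of level $n+1$ and wire $k\ge H(n)+I(n)$ continues as wire $k+\Delta(n)$. Edges are the resulting maximal wire chains; each joins two vertices, or a vertex and the top/bottom boundary, or the two boundaries. $D$ is connected if the multigraph whose vertices are the vertices of $D$ and whose edges are the edges of $D$ joining two vertices is connected. For $0\le n\le N-2$, a right exchange at height $n$ is admissible when $H(n+1)\ge H(n)+O(n)$ and yields $D'$ identical to $D$ except $H'(n)=H(n+1)-\Delta(n)$, $I'(n)=I(n+1)$, $O'(n)=O(n+1)$, $H'(n+1)=H(n)$, $I'(n+1)=I(n)$, $O'(n+1)=O(n)$; we write $D\to_R D'$. *)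

theory Defs
  imports Complex_Main "Graph_Theory.Graph_Theory"
begin

(* A diagram (S, N, H, I, O).  Only the values of hpos, ins and outs below nverts are meaningful;
   validity, edges and admissible exchanges neither depend on the others nor change them. *)
record diagram =
  src :: nat                  (* S *)
  nverts :: nat               (* N *)
  hpos :: "nat \<Rightarrow> nat"    (* H *)
  ins :: "nat \<Rightarrow> nat"     (* I *)
  outs :: "nat \<Rightarrow> nat"    (* O *)

(* \<Delta> may be negative, hence int.  The width W is therefore also int; it is nonnegative at
   all levels up to nverts when the diagram is valid. *)
definition delta :: "diagram \<Rightarrow> nat \<Rightarrow> int" where
  "delta D n = int (outs D n) - int (ins D n)"

fun width :: "diagram \<Rightarrow> nat \<Rightarrow> int" where
  "width D 0 = int (src D)"
| "width D (Suc n) = width D n + delta D n"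

definition valid :: "diagram \<Rightarrow> bool" where
  "valid D \<longleftrightarrow> (\<forall>n < nverts D. width D n \<ge> int (hpos D n + ins D n))"

(* (n, k) is the k-th wire crossing level n. *)
type_synonym wire = "nat \<times> nat"

definition wires :: "diagram \<Rightarrow> wire set" where
  "wires D = {(n, k). n \<le> nverts D \<and> int k < width D n}"

definition input_wires :: "diagram \<Rightarrow> nat \<Rightarrow> wire set" where
  "input_wires D n = {(n, k) | k. hpos D n \<le> k \<and> k < hpos D n + ins D n}"

definition output_wires :: "diagram \<Rightarrow> nat \<Rightarrow> wire set" where
  "output_wires D n = {(Suc n, k) | k. hpos D n \<le> k \<and> k < hpos D n + outs D n}"

definition continues_as :: "diagram \<Rightarrow> wire \<Rightarrow> wire \<Rightarrow> bool" where
  "continues_as D w w' \<longleftrightarrow> w \<in> wires D \<and> w' \<in> wires D \<and>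
     (\<exists>n k k'. n < nverts D \<and> w = (n, k) \<and> w' = (Suc n, k') \<and>
        (k < hpos D n \<and> k' = k
         \<or> hpos D n + ins D n \<le> k \<and> int k' = int k + delta D n))"

definition is_edge :: "diagram \<Rightarrow> wire list \<Rightarrow> bool" where
  "is_edge D ws \<longleftrightarrow> ws \<noteq> [] \<and> set ws \<subseteq> wires D \<and> successively (continues_as D) ws \<and>
     (\<nexists>w. continues_as D w (hd ws)) \<and> (\<nexists>w. continues_as D (last ws) w)"

definition joins :: "diagram \<Rightarrow> wire list \<Rightarrow> nat \<Rightarrow> nat \<Rightarrow> bool" where
  "joins D ws u v \<longleftrightarrow> u < nverts D \<and> v < nverts D \<and>
     hd ws \<in> output_wires D u \<and> last ws \<in> input_wires D v"

(* The multigraph of the vertices and of the edges joining two vertices.  Arcs are directed from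
   top to bottom, but the library's connected is connectivity of the underlying undirected
   graph.  Outputs of u lie on level u + 1 and inputs of v on level v, so the ends of an edge can
   be read off the levels of its first and last wire. *)
definition diagram_graph :: "diagram \<Rightarrow> (nat, wire list) pre_digraph" where
  "diagram_graph D =
     \<lparr> verts = {..<nverts D},
       arcs = {ws. is_edge D ws \<and> (\<exists>u v. joins D ws u v)},
       tail = (\<lambda>ws. fst (hd ws) - 1),
       head = (\<lambda>ws. fst (last ws)) \<rparr>"

lemma joins_iff_ends:
  assumes "ws \<in> arcs (diagram_graph D)"
  shows "joins D ws u v \<longleftrightarrow>
    u = tail (diagram_graph D) ws \<and> v = head (diagram_graph D) ws"
  using assms by (auto simp: diagram_graph_def joins_def output_wires_def input_wires_def)

lemma wf_digraph_diagram_graph: "wf_digraph (diagram_graph D)"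
  by unfold_locales
    (auto simp: diagram_graph_def joins_def output_wires_def input_wires_def)

(* The library's connected requires a vertex; the diagram without vertices counts as connected. *)
definition diagram_connected :: "diagram \<Rightarrow> bool" where
  "diagram_connected D \<longleftrightarrow> nverts D = 0 \<or> Digraph_Component.connected (diagram_graph D)"

definition right_admissible :: "diagram \<Rightarrow> nat \<Rightarrow> bool" where
  "right_admissible D n \<longleftrightarrow> Suc n < nverts D \<and> hpos D (Suc n) \<ge> hpos D n + outs D n"

(* For an admissible exchange the argument of nat is nonnegative. *)
definition exchange_right :: "diagram \<Rightarrow> nat \<Rightarrow> diagram" where
  "exchange_right D n = D\<lparr>
     hpos := (hpos D)(n := nat (int (hpos D (Suc n)) - delta D n), Suc n := hpos D n),
     ins := (ins D)(n := ins D (Suc n), Suc n := ins D n),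
     outs := (outs D)(n := outs D (Suc n), Suc n := outs D n)\<rparr>"

definition right_step :: "diagram \<Rightarrow> diagram \<Rightarrow> bool" (infix "\<rightarrow>\<^sub>R" 50) where
  "D \<rightarrow>\<^sub>R D' \<longleftrightarrow> (\<exists>n. right_admissible D n \<and> D' = exchange_right D n)"

end

(* An exchange of two vertices turns the pair counterclockwise by half a turn.  Follow an edge from
   x to y through the reductions, and let u be a third vertex.  The edge is vertically monotone, so it
   crosses the level of u at most once, and its crossing number with u (-1 if it passes on the left
   of u, 1 on the right, 0 if it does not cross) changes by +1 at an exchange of u with x, by -1 at
   an exchange of u with y, and never otherwise.  Since x and y cannot be exchanged with each other,
   the numbers of exchanges of u with x and of u with y differ by at most 2 at any time.  By
   connectedness the number of exchanges of any two vertices is bounded. *)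
theory Submission
  imports Defs "HOL-Combinatorics.Transposition"
begin

section \<open>Threads and the effect of a single exchange\<close>

definition passes :: "diagram \<Rightarrow> nat \<Rightarrow> nat \<Rightarrow> nat \<Rightarrow> bool" where
  "passes D m k k' \<longleftrightarrow>
     k < hpos D m \<and> k' = k \<or> hpos D m + ins D m \<le> k \<and> k' + ins D m = k + outs D m"

(* p gives the horizontal positions of an edge from the vertex at height i to the one at height j;
   only its values on the levels i + 1, ..., j matter. *)
definition thread :: "diagram \<Rightarrow> nat \<Rightarrow> nat \<Rightarrow> (nat \<Rightarrow> nat) \<Rightarrow> bool" where
  "thread D i j p \<longleftrightarrow> i < j \<and>
     hpos D i \<le> p (Suc i) \<and> p (Suc i) < hpos D i + outs D i \<and>
     hpos D j \<le> p j \<and> p j < hpos D j + ins D j \<and>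
     (\<forall>m. i < m \<and> m < j \<longrightarrow> passes D m (p m) (p (Suc m)))"

text \<open>On a thread, \<open>passes\<close> leaves only left and right at a crossed vertex, so a
  failed test means right.\<close>

definition side :: "diagram \<Rightarrow> nat \<Rightarrow> nat \<Rightarrow> (nat \<Rightarrow> nat) \<Rightarrow> nat \<Rightarrow> int" where
  "side D i j p u = (if i < u \<and> u < j then if p u < hpos D u then -1 else 1 else 0)"

lemma abs_side_le: "\<bar>side D i j p u\<bar> \<le> 1"
  by (simp add: side_def)

lemma exchange_right_simps:
  assumes "right_admissible D n"
  shows "hpos (exchange_right D n) n + outs D n = hpos D (Suc n) + ins D n"
    "hpos (exchange_right D n) (Suc n) = hpos D n"
    "ins (exchange_right D n) n = ins D (Suc n)"
    "ins (exchange_right D n) (Suc n) = ins D n"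
    "outs (exchange_right D n) n = outs D (Suc n)"
    "outs (exchange_right D n) (Suc n) = outs D n"
    "nverts (exchange_right D n) = nverts D"
  using assms by (auto simp: exchange_right_def right_admissible_def delta_def)

lemma exchange_right_other:
  assumes "m \<noteq> n" "m \<noteq> Suc n"
  shows "hpos (exchange_right D n) m = hpos D m"
    "ins (exchange_right D n) m = ins D m"
    "outs (exchange_right D n) m = outs D m"
  using assms by (auto simp: exchange_right_def)

text \<open>Only the two exchanged vertices move, and the edge needs a new position on level n + 1
  at most. When a third vertex is exchanged with an end of the edge, the edge starts or stops
  crossing its level; the signs follow because the lower vertex lies on the right and moves
  up.\<close>

lemma thread_exchange_right:
  assumes adm: "right_admissible D n" and th: "thread D i j p"
  defines "\<tau> \<equiv> transpose n (Suc n)"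
  shows "\<exists>p'. thread (exchange_right D n) (\<tau> i) (\<tau> j) p' \<and>
    (\<forall>u. u \<noteq> i \<and> u \<noteq> j \<longrightarrow> side (exchange_right D n) (\<tau> i) (\<tau> j) p' (\<tau> u) =
       side D i j p u + of_bool ({u, i} = {n, Suc n}) - of_bool ({u, j} = {n, Suc n}))"
proof -
  define E where "E = exchange_right D n"
  note same = exchange_right_simps(2-)[OF adm, folded E_def]
  have hE: "hpos E n + outs D n = hpos D (Suc n) + ins D n"
    using exchange_right_simps(1)[OF adm] by (simp add: E_def)
  note other = exchange_right_other[where D = D and n = n, folded E_def]
  have sep: "hpos D n + outs D n \<le> hpos D (Suc n)"
    using adm by (simp add: right_admissible_def)
  have ij: "i < j"
    and tl: "hpos D i \<le> p (Suc i)" "p (Suc i) < hpos D i + outs D i"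
    and hd: "hpos D j \<le> p j" "p j < hpos D j + ins D j"
    and ps: "\<And>m. i < m \<Longrightarrow> m < j \<Longrightarrow> passes D m (p m) (p (Suc m))"
    using th by (auto simp: thread_def)
  have tau: "\<tau> n = Suc n" "\<tau> (Suc n) = n" "\<And>m. m \<noteq> n \<Longrightarrow> m \<noteq> Suc n \<Longrightarrow> \<tau> m = m"
    by (auto simp: \<tau>_def transpose_def)
  \<comment> \<open>It suffices to treat vertices away from the exchange and the two that swap
    heights; for the latter the indicators only ask whether the partner is an end of the
    edge.\<close>
  have goal: ?thesis
    if 1: "thread E (\<tau> i) (\<tau> j) p'"
      and 2: "\<And>u. u \<noteq> i \<Longrightarrow> u \<noteq> j \<Longrightarrow> u \<noteq> n \<Longrightarrow> u \<noteq> Suc n \<Longrightarrow>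
        side E (\<tau> i) (\<tau> j) p' u = side D i j p u"
      and 3: "n \<noteq> i \<Longrightarrow> n \<noteq> j \<Longrightarrow>
        side E (\<tau> i) (\<tau> j) p' (Suc n) = side D i j p n + of_bool (i = Suc n) - of_bool (j = Suc n)"
      and 4: "Suc n \<noteq> i \<Longrightarrow> Suc n \<noteq> j \<Longrightarrow>
        side E (\<tau> i) (\<tau> j) p' n = side D i j p (Suc n) + of_bool (i = n) - of_bool (j = n)"
    for p'
  proof (intro exI conjI allI impI)
    show "thread (exchange_right D n) (\<tau> i) (\<tau> j) p'" using 1 by (simp add: E_def)
    fix u assume u: "u \<noteq> i \<and> u \<noteq> j"
    show "side (exchange_right D n) (\<tau> i) (\<tau> j) p' (\<tau> u) =
       side D i j p u + of_bool ({u, i} = {n, Suc n}) - of_bool ({u, j} = {n, Suc n})"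
      unfolding E_def[symmetric]
      using u 2[of u] 3 4 by (cases "u = n"; cases "u = Suc n") (auto simp: tau doubleton_eq_iff)
  qed
  consider "i = n" | "i = Suc n" | "j = n" | "j = Suc n" "i \<noteq> n"
    | "i < n" "Suc n < j" | "j < n" | "Suc n < i"
    using ij by linarith
  then show ?thesis
  proof cases
    case 1
    \<comment> \<open>An output of the upper vertex lies left of all inputs of the lower one, so the
      edge cannot end there.\<close>
    have j: "Suc n < j" using ij 1 tl hd sep by (cases "j = Suc n") auto
    \<comment> \<open>The edge passes left of the lower vertex, so it keeps its position on level n
      + 2, where it starts after the exchange.\<close>
    have eq: "p (Suc (Suc n)) = p (Suc n)"
      using ps[of "Suc n"] 1 j tl sep by (auto simp: passes_def)
    show ?thesis
    proof (rule goal[of p])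
      show "thread E (\<tau> i) (\<tau> j) p"
        using 1 j tl hd eq ps by (auto simp: thread_def passes_def tau same other)
    qed (use 1 j tl sep in \<open>auto simp: side_def tau same other\<close>)
  next
    case 2
    \<comment> \<open>The edge now starts one level higher and passes right of the lowered vertex;
      undoing the shift by that vertex gives its position there. By \<open>sep\<close> the
      subtraction is exact.\<close>
    define p' where "p' = p(Suc n := p (Suc (Suc n)) + ins D n - outs D n)"
    show ?thesis
    proof (rule goal[of p'])
      show "thread E (\<tau> i) (\<tau> j) p'"
        using 2 ij tl hd sep hE ps
        by (auto simp: thread_def passes_def tau same other p'_def)
    qed (use 2 ij tl sep hE in \<open>auto simp: side_def tau same other p'_def\<close>)
  next
    case 3
    \<comment> \<open>The edge now ends one level lower and passes left of the risen vertex, where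
      positions do not shift.\<close>
    define p' where "p' = p(Suc n := p n)"
    show ?thesis
    proof (rule goal[of p'])
      show "thread E (\<tau> i) (\<tau> j) p'"
        using 3 ij tl hd sep hE ps
        by (auto simp: thread_def passes_def tau same other p'_def less_Suc_eq)
    qed (use 3 ij hd sep hE in \<open>auto simp: side_def tau same other p'_def\<close>)
  next
    case 4
    have i: "i < n" using 4 ij by simp
    \<comment> \<open>An edge ending at the lower vertex must pass right of the upper one; after the
      exchange it ends before meeting it.\<close>
    have eq: "hpos D n + ins D n \<le> p n" "p (Suc n) + ins D n = p n + outs D n"
      using ps[of n] 4 i hd sep by (auto simp: passes_def)
    show ?thesis
    proof (rule goal[of p])
      show "thread E (\<tau> i) (\<tau> j) p"
        using 4 i tl hd eq ps sep hE by (auto simp: thread_def passes_def tau same other)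
    qed (use 4 i eq sep in \<open>auto simp: side_def tau same other\<close>)
  next
    case 5
    \<comment> \<open>By \<open>sep\<close> the edge runs left of both vertices, between them or
      right of both. It now meets the old lower vertex first and is shifted by it exactly when
      passing on its right.\<close>
    define p' where "p' = p(Suc n := if p (Suc n) < hpos D (Suc n) then p n
      else p n + outs D (Suc n) - ins D (Suc n))"
    have u: "passes D n (p n) (p (Suc n))" and v: "passes D (Suc n) (p (Suc n)) (p (Suc (Suc n)))"
      using ps[of n] ps[of "Suc n"] 5 by auto
    have u': "passes E n (p' n) (p' (Suc n))"
      and v': "passes E (Suc n) (p' (Suc n)) (p' (Suc (Suc n)))"
      and s: "p' (Suc n) < hpos D n \<longleftrightarrow> p n < hpos D n"
        "p n < hpos E n \<longleftrightarrow> p (Suc n) < hpos D (Suc n)"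
      using u v sep hE by (auto simp: passes_def p'_def same)
    show ?thesis
    proof (rule goal[of p'])
      have "passes E m (p' m) (p' (Suc m))" if "i < m" "m < j" for m
        using that ps[of m] u' v'
        by (cases "m = n"; cases "m = Suc n") (auto simp: passes_def other p'_def)
      then show "thread E (\<tau> i) (\<tau> j) p'"
        using 5 tl hd by (auto simp: thread_def tau other p'_def)
    qed (use 5 s in \<open>auto simp: side_def tau same other p'_def\<close>)
  next
    case 6
    show ?thesis
    proof (rule goal[of p])
      show "thread E (\<tau> i) (\<tau> j) p"
        using 6 ij tl hd ps by (auto simp: thread_def passes_def tau other)
    qed (use 6 ij in \<open>auto simp: side_def tau other\<close>)
  next
    case 7
    show ?thesis
    proof (rule goal[of p])
      show "thread E (\<tau> i) (\<tau> j) p"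
        using 7 ij tl hd ps by (auto simp: thread_def passes_def tau other)
    qed (use 7 ij in \<open>auto simp: side_def tau other\<close>)
  qed
qed

text \<open>On adjacent heights the only wire of the thread would be an output of the upper and an
  input of the lower vertex, but admissibility puts those outputs left of those inputs.\<close>

lemma thread_not_exchanged:
  assumes "right_admissible D n" "thread D i j p"
  shows "{i, j} \<noteq> {n, Suc n}"
  using assms by (auto simp: thread_def right_admissible_def doubleton_eq_iff)

section \<open>Edges of the diagram as threads\<close>

lemma thread_if_joins:
  assumes edge: "is_edge D ws" and joins: "joins D ws u v"
  shows "\<exists>p. thread D u v p"
proof -
  \<comment> \<open>An edge leaving \<open>u\<close> starts on level u + 1 and descends one level
    per wire, so this index picks its wire on level \<open>l\<close>.\<close>
  define p where "p l = snd (ws ! (l - Suc u))" for l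
  have ne: "ws \<noteq> []" and succ: "successively (continues_as D) ws"
    using edge by (auto simp: is_edge_def)
  have step: "continues_as D (ws ! m) (ws ! Suc m)" if "Suc m < length ws" for m
    using succ that by (simp add: successively_conv_nth)
  have lev: "fst (ws ! m) = Suc u + m" if "m < length ws" for m
    using that
  proof (induction m)
    case 0
    then show ?case using joins ne by (auto simp: joins_def output_wires_def hd_conv_nth)
  next
    case (Suc m)
    then show ?case using step[of m] by (auto simp: continues_as_def)
  qed
  have v: "v = u + length ws"
    using lev[of "length ws - 1"] joins ne
    by (auto simp: joins_def input_wires_def last_conv_nth)
  have uv: "u < v" using v ne by simp
  moreover have "hpos D u \<le> p (Suc u)" "p (Suc u) < hpos D u + outs D u"
    using joins ne by (auto simp: joins_def output_wires_def hd_conv_nth p_def)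
  moreover have "hpos D v \<le> p v" "p v < hpos D v + ins D v"
    using joins ne v by (auto simp: joins_def input_wires_def last_conv_nth p_def)
  moreover have "passes D m (p m) (p (Suc m))" if "u < m" "m < v" for m
  proof -
    have "continues_as D (ws ! (m - Suc u)) (ws ! (m - u))"
      using step[of "m - Suc u"] that v by (simp add: Suc_diff_Suc)
    moreover have "fst (ws ! (m - Suc u)) = m" using lev[of "m - Suc u"] that v by simp
    ultimately show ?thesis
      by (auto simp: continues_as_def p_def passes_def delta_def)
  qed
  ultimately show ?thesis by (auto simp: thread_def)
qed

section \<open>Exchange counts along an infinite reduction\<close>

definition right_path :: "(nat \<Rightarrow> diagram) \<Rightarrow> (nat \<Rightarrow> nat) \<Rightarrow> bool" where
  "right_path D n \<longleftrightarrow>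
     (\<forall>t. right_admissible (D t) (n t) \<and> D (Suc t) = exchange_right (D t) (n t))"

lemma right_pathD:
  assumes "right_path D n"
  shows "right_admissible (D t) (n t)" "D (Suc t) = exchange_right (D t) (n t)"
  using assms by (auto simp: right_path_def)

(* Vertices are named by their heights in D 0; height n t x is the height of vertex x in D t. *)
primrec height :: "(nat \<Rightarrow> nat) \<Rightarrow> nat \<Rightarrow> nat \<Rightarrow> nat" where
  "height n 0 x = x"
| "height n (Suc t) x = transpose (n t) (Suc (n t)) (height n t x)"

definition exchanges :: "(nat \<Rightarrow> nat) \<Rightarrow> nat \<Rightarrow> nat \<Rightarrow> nat \<Rightarrow> nat" where
  "exchanges n t u x = (\<Sum>s<t. of_bool ({height n s u, height n s x} = {n s, Suc (n s)}))"

lemma exchanges_self: "exchanges n t u u = 0"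
  by (auto simp: exchanges_def doubleton_eq_iff)

lemma inj_height: "inj (height n t)"
proof (induction t)
  case (Suc t)
  have "inj (transpose (n t) (Suc (n t)) \<circ> height n t)"
    using Suc by (intro inj_compose inj_on_transpose)
  then show ?case by (simp add: comp_def)
qed simp

text \<open>The one-step changes of side add up to the two counts. Each time has its own
  \<open>p\<close>; injectivity of \<open>height\<close> keeps a third vertex apart from the
  ends.\<close>

lemma thread_along_path:
  assumes path: "right_path D n" and th: "thread (D 0) x y p\<^sub>0"
  shows "\<exists>p. thread (D t) (height n t x) (height n t y) p \<and>
    (\<forall>u. u \<noteq> x \<and> u \<noteq> y \<longrightarrow>
      side (D t) (height n t x) (height n t y) p (height n t u) =
      side (D 0) x y p\<^sub>0 u + int (exchanges n t u x) - int (exchanges n t u y))"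
proof (induction t)
  case 0
  then show ?case using th by (auto simp: exchanges_def)
next
  case (Suc t)
  then obtain p where p: "thread (D t) (height n t x) (height n t y) p"
    and sd: "\<And>u. u \<noteq> x \<Longrightarrow> u \<noteq> y \<Longrightarrow>
      side (D t) (height n t x) (height n t y) p (height n t u) =
      side (D 0) x y p\<^sub>0 u + int (exchanges n t u x) - int (exchanges n t u y)"
    by blast
  have "right_admissible (D t) (n t)" and D: "D (Suc t) = exchange_right (D t) (n t)"
    using right_pathD[OF path] by blast+
  from thread_exchange_right[OF this(1) p, folded D height.simps] obtain p'
    where p': "thread (D (Suc t)) (height n (Suc t) x) (height n (Suc t) y) p'"
    and sd': "\<And>k. k \<noteq> height n t x \<Longrightarrow> k \<noteq> height n t y \<Longrightarrow>
      side (D (Suc t)) (height n (Suc t) x) (height n (Suc t) y) p'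
          (transpose (n t) (Suc (n t)) k) =
        side (D t) (height n t x) (height n t y) p k
          + of_bool ({k, height n t x} = {n t, Suc (n t)})
          - of_bool ({k, height n t y} = {n t, Suc (n t)})"
    by blast
  show ?case
  proof (intro exI conjI allI impI, rule p')
    fix u assume u: "u \<noteq> x \<and> u \<noteq> y"
    then have "height n t u \<noteq> height n t x" "height n t u \<noteq> height n t y"
      by (auto simp: inj_eq[OF inj_height])
    from sd'[OF this] show "side (D (Suc t)) (height n (Suc t) x) (height n (Suc t) y) p'
        (height n (Suc t) u) =
      side (D 0) x y p\<^sub>0 u + int (exchanges n (Suc t) u x) - int (exchanges n (Suc t) u y)"
      using sd[of u] u by (simp add: exchanges_def)
  qed
qed

text \<open>The edge persists as a thread between the current heights of its ends, which rules out
  every exchange of the two.\<close>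

lemma exchanges_ends:
  assumes path: "right_path D n" and th: "thread (D 0) x y p"
  shows "exchanges n t x y = 0"
proof -
  have "{height n s x, height n s y} \<noteq> {n s, Suc (n s)}" for s
    using thread_along_path[OF path th, of s] thread_not_exchanged[OF right_pathD(1)[OF path]]
    by blast
  then show ?thesis by (simp add: exchanges_def)
qed

lemma exchanges_commute: "exchanges n t u x = exchanges n t x u"
  by (simp add: exchanges_def insert_commute)

text \<open>For a third vertex this is the difference of two sides, each between -1 and 1; for an
  end of the edge both counts vanish.\<close>

lemma exchanges_edge_diff:
  assumes path: "right_path D n" and th: "thread (D 0) x y p"
  shows "\<bar>int (exchanges n t u x) - int (exchanges n t u y)\<bar> \<le> 2"
proof -
  consider "u = x" | "u = y" | "u \<noteq> x" "u \<noteq> y" by blast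
  then show ?thesis
  proof cases
    case 1
    then show ?thesis using exchanges_ends[OF path th] exchanges_self by simp
  next
    case 2
    then show ?thesis
      using exchanges_ends[OF path th] exchanges_self exchanges_commute[of n t y x] by simp
  next
    case 3
    obtain q where "side (D t) (height n t x) (height n t y) q (height n t u) =
        side (D 0) x y p u + int (exchanges n t u x) - int (exchanges n t u y)"
      using thread_along_path[OF path th, of t] 3 by blast
    then show ?thesis
      using abs_side_le[of "D t" "height n t x" "height n t y" q "height n t u"]
        abs_side_le[of "D 0" x y p u] by linarith
  qed
qed

text \<open>Induction along an undirected path from \<open>u\<close>: the count of \<open>u\<close>
  with itself is 0, and each edge raises the bound by 2.\<close>

lemma exchanges_bounded:
  assumes path: "right_path D n" and conn: "Digraph_Component.connected (diagram_graph (D 0))"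
    and uv: "u < nverts (D 0)" "v < nverts (D 0)"
  shows "\<exists>B. \<forall>t. exchanges n t u v \<le> B"
proof -
  let ?G = "diagram_graph (D 0)"
  have "u \<rightarrow>\<^sup>*\<^bsub>mk_symmetric ?G\<^esub> v"
    using conn uv
    by (auto simp: Digraph_Component.connected_def strongly_connected_def diagram_graph_def)
  then have "(u, v) \<in> (arcs_ends (mk_symmetric ?G))\<^sup>*"
    by (rule reachable_rtranclI)
  then show ?thesis
  proof (induction rule: rtrancl_induct)
    case base
    then show ?case by (auto simp: exchanges_self)
  next
    case (step x y)
    then obtain B where B: "\<And>t. exchanges n t u x \<le> B" by blast
    have "(x, y) \<in> parcs (mk_symmetric ?G)" using step(2) by simp
    \<comment> \<open>The path may follow the arc in either direction; the bound on the difference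
      is symmetric in its ends.\<close>
    then obtain e where e: "e \<in> arcs ?G"
      and xy: "(x, y) = (tail ?G e, head ?G e) \<or> (x, y) = (head ?G e, tail ?G e)"
      by (auto simp: parcs_mk_symmetric)
    have "is_edge (D 0) e" "joins (D 0) e (tail ?G e) (head ?G e)"
      using e joins_iff_ends[OF e] by (auto simp: diagram_graph_def)
    then obtain p where "thread (D 0) (tail ?G e) (head ?G e) p"
      using thread_if_joins by blast
    from exchanges_edge_diff[OF path this, of _ u] xy
    have diff: "\<bar>int (exchanges n t u x) - int (exchanges n t u y)\<bar> \<le> 2" for t
      by (auto simp: abs_minus_commute)
    have "exchanges n t u y \<le> B + 2" for t
      using diff[of t] B[of t] by linarith
    then show ?case by blast
  qed
qed

section \<open>Length of a reduction against the total count\<close>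

lemma nverts_right_path:
  assumes "right_path D n"
  shows "nverts (D t) = nverts (D 0)"
proof (induction t)
  case (Suc t)
  then show ?case
    by (simp add: right_pathD(2)[OF assms] exchange_right_simps(7)[OF right_pathD(1)[OF assms]])
qed simp

lemma Suc_less_nverts:
  assumes "right_path D n"
  shows "Suc (n t) < nverts (D 0)"
  using right_pathD(1)[OF assms, of t] nverts_right_path[OF assms, of t]
  by (simp add: right_admissible_def)

text \<open>Exchanges stay within the range of heights, so \<open>height n t\<close> maps it
  injectively into itself, hence onto it by finiteness. Thus the exchanged heights always belong to
  vertices of \<open>D 0\<close>.\<close>

lemma bij_betw_height:
  assumes "right_path D n"
  shows "bij_betw (height n t) {..<nverts (D 0)} {..<nverts (D 0)}"
proof -
  let ?V = "{..<nverts (D 0)}"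
  have "Suc (n s) \<in> ?V" for s
    using Suc_less_nverts[OF assms] by simp
  then have "height n t ` ?V \<subseteq> ?V"
    by (induction t) (auto simp: transpose_def Suc_lessD)
  then show ?thesis
    by (metis bij_betw_def endo_inj_surj finite_lessThan inj_height inj_on_subset subset_UNIV)
qed

text \<open>Every step exchanges some pair of vertices and so adds at least 1 to the double
  sum.\<close>

lemma length_le_exchanges:
  assumes path: "right_path D n"
  shows "t \<le> (\<Sum>u<nverts (D 0). \<Sum>v<nverts (D 0). exchanges n t u v)"
proof -
  let ?V = "{..<nverts (D 0)}"
  let ?f = "\<lambda>s u v. of_bool ({height n s u, height n s v} = {n s, Suc (n s)}) :: nat"
  have "1 \<le> (\<Sum>u\<in>?V. \<Sum>v\<in>?V. ?f s u v)" for s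
  proof -
    have "n s \<in> height n s ` ?V" "Suc (n s) \<in> height n s ` ?V"
      using bij_betw_imp_surj_on[OF bij_betw_height[OF path, of s]]
        Suc_less_nverts[OF path, of s] by simp_all
    then obtain u v where uv: "u \<in> ?V" "v \<in> ?V" "height n s u = n s" "height n s v = Suc (n s)"
      by (metis imageE)
    have "1 = ?f s u v" using uv by simp
    also have "\<dots> \<le> (\<Sum>v\<in>?V. ?f s u v)" using uv by (intro member_le_sum) auto
    also have "\<dots> \<le> (\<Sum>u\<in>?V. \<Sum>v\<in>?V. ?f s u v)"
      using uv by (intro member_le_sum[where f = "\<lambda>u. \<Sum>v\<in>?V. ?f s u v"]) auto
    finally show ?thesis .
  qed
  then have "(\<Sum>s<t. 1) \<le> (\<Sum>s<t. \<Sum>u\<in>?V. \<Sum>v\<in>?V. ?f s u v)"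
    by (intro sum_mono)
  also have "\<dots> = (\<Sum>u\<in>?V. \<Sum>s<t. \<Sum>v\<in>?V. ?f s u v)" by (rule sum.swap)
  also have "\<dots> = (\<Sum>u\<in>?V. \<Sum>v\<in>?V. \<Sum>s<t. ?f s u v)"
    by (intro sum.cong refl sum.swap)
  finally show ?thesis by (simp add: exchanges_def)
qed

theorem theorem30:
  fixes D\<^sub>0 :: diagram
  assumes "valid D\<^sub>0" and "diagram_connected D\<^sub>0"
  shows "\<nexists>D :: nat \<Rightarrow> diagram. D 0 = D\<^sub>0 \<and> (\<forall>i. D i \<rightarrow>\<^sub>R D (Suc i))"
proof
  assume "\<exists>D :: nat \<Rightarrow> diagram. D 0 = D\<^sub>0 \<and> (\<forall>i. D i \<rightarrow>\<^sub>R D (Suc i))"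
  then obtain D where D0: "D 0 = D\<^sub>0" and "\<forall>i. D i \<rightarrow>\<^sub>R D (Suc i)" by blast
  then have "\<forall>i. \<exists>n. right_admissible (D i) n \<and> D (Suc i) = exchange_right (D i) n"
    by (simp add: right_step_def)
  \<comment> \<open>Following the vertices requires one definite height for every step.\<close>
  from choice[OF this] obtain n where path: "right_path D n"
    unfolding right_path_def by blast
  let ?N = "nverts (D 0)"
  \<comment> \<open>An admissible exchange needs two vertices, so the empty case of
    \<open>diagram_connected\<close> does not arise.\<close>
  have "?N \<noteq> 0" using Suc_less_nverts[OF path, of 0] by simp
  then have conn: "Digraph_Component.connected (diagram_graph (D 0))"
    using assms(2) D0 by (simp add: diagram_connected_def)
  define B where "B u v = (SOME b. \<forall>t. exchanges n t u v \<le> b)" for u v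
  have B: "exchanges n t u v \<le> B u v" if "u < ?N" "v < ?N" for u v t
    using someI_ex[OF exchanges_bounded[OF path conn that]] by (simp add: B_def)
  \<comment> \<open>\<open>b\<close> bounds the total count at all times, so b + 1 steps are already
    too many.\<close>
  define b where "b = (\<Sum>u<?N. \<Sum>v<?N. B u v)"
  have "Suc b \<le> (\<Sum>u<?N. \<Sum>v<?N. exchanges n (Suc b) u v)"
    by (rule length_le_exchanges[OF path])
  also have "\<dots> \<le> b" unfolding b_def by (intro sum_mono B) auto
  finally show False by simp
qed

end
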